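(* Let $\{X_n\}_{n\in\mathbb{N}}$ be a sequence of finite metric spaces with $|X_n|\to\infty$. Then the following are equivalent: (1) $\{X_n\}_{n\in\mathbb{N}}$ is a sequence of asymptotic expanders; (2) there exist $c>0$, a positive decreasing sequence $\{\alpha_k\}_{k\in\mathbb{N}}$ with $\alpha_k\to0$, a positive sequence $\{R_k\}_{k\in\mathbb{N}}$, and for each $n\in\mathbb{N}$ a sequence of subsets $\{Y_{n,k}\}_{k\in\mathbb{N}}$ of $X_n$, such that for all $n,k\in\mathbb{N}$: (i) $|Y_{n,k}|\ge(1-\alpha_k)|X_n|$; and (ii) for each non-empty $A\subseteq Y_{n,k}$ with $|A|\le\frac12|Y_{n,k}|$, we have $|\partial^{Y_{n,k}}_{R_k}A|>c|A|$.
   Context: For a metric space $(X,d)$, $A\subseteq X$ and $R>0$, let $\partial_R A=\partial_R^X A=\{x\in X\setminus A : d(x,A)\le R\}$. If $A\subseteq Y\subseteq X$ and $Y$ carries the metric induced from $X$, then $\partial^Y_R A$ denotes the $R$-boundary of $A$ inside $Y$, i.e. $\partial_R^Y A=\partial_R^X A\cap Y$. A sequence $\{X_n\}_{n\in\mathbb{N}}$ of finite metric spaces with $|X_n|\to\infty$ is a sequence of asymptotic expanders if for every $\alpha\in(0,\frac12]$ there exist $c_\alpha\in(0,1)$ and $R_\alpha>0$ such that for every $n$ and every $A\subseteq X_n$ with $\alpha|X_n|\le|A|\le\frac12|X_n|$ we have $|\partial_{R_\alpha}A|>c_\alpha|A|$. *)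

theory Defs
  imports "HOL-Analysis.Analysis"
begin

text \<open>
  The distance from a point to a set takes values in \<^typ>\<open>ereal\<close>, so that every point is at
  distance \<open>\<infinity>\<close> from the empty set and the boundary of the empty set is empty.
\<close>

definition point_set_dist :: "('a \<Rightarrow> 'a \<Rightarrow> real) \<Rightarrow> 'a \<Rightarrow> 'a set \<Rightarrow> ereal" where
  "point_set_dist d x A = (INF a\<in>A. ereal (d x a))"

definition R_boundary :: "'a set \<Rightarrow> ('a \<Rightarrow> 'a \<Rightarrow> real) \<Rightarrow> real \<Rightarrow> 'a set \<Rightarrow> 'a set" where
  "R_boundary X d R A = {x \<in> X - A. point_set_dist d x A \<le> ereal R}"

text \<open>The induced metric on a subset \<open>Y\<close> of \<open>X\<close> is given by the same function \<open>d\<close>.\<close>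

lemma R_boundary_subspace:
  assumes "Y \<subseteq> X"
  shows "R_boundary Y d R A = R_boundary X d R A \<inter> Y"
  using assms by (auto simp: R_boundary_def)

text \<open>
  A sequence of metric spaces is given by carriers \<open>X n\<close> in one type, each with its own metric
  \<open>d n\<close>; the metrics at different indices are unrelated. The predicate is intended for sequences
  of non-empty finite metric spaces whose cardinalities tend to infinity.
\<close>

definition asymptotic_expanders :: "(nat \<Rightarrow> 'a set) \<Rightarrow> (nat \<Rightarrow> 'a \<Rightarrow> 'a \<Rightarrow> real) \<Rightarrow> bool" where
  "asymptotic_expanders X d \<longleftrightarrow>
     (\<forall>\<alpha>::real. 0 < \<alpha> \<and> \<alpha> \<le> 1/2 \<longrightarrow>
       (\<exists>c R::real. 0 < c \<and> c < 1 \<and> 0 < R \<and>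
         (\<forall>n. \<forall>A \<subseteq> X n.
            \<alpha> * real (card (X n)) \<le> real (card A) \<and> real (card A) \<le> 1/2 * real (card (X n)) \<longrightarrow>
            real (card (R_boundary (X n) (d n) R A)) > c * real (card A))))"

end

theory Submission
  imports Defs
begin

text \<open>
  For (1) implies (2), the expansion constant can be made independent of \<open>\<alpha>\<close> at the cost of
  enlarging \<open>R\<close>: a set of size at least \<open>\<alpha>|X|\<close> but less than \<open>|X|/4\<close> grows by at least
  \<open>c\<alpha>|X|\<close> with each enlargement, so after boundedly many enlargements it fills half of \<open>X\<close> and
  has at least doubled, while sets of size at least \<open>|X|/4\<close> have the fixed constant belonging to
  \<open>1/4\<close>. With a uniform constant, delete from \<open>X\<close> a non-expanding set \<open>F\<close> of maximal
  cardinality among those of size at most \<open>|X|/2\<close>; then \<open>F\<close> is small. A non-expanding set in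
  \<open>X - F\<close> could be added to \<open>F\<close> unless it is itself of size at least \<open>|X|/4\<close>, and then its
  boundary in \<open>X\<close> is too large to be hidden in \<open>F\<close>.

  For (2) implies (1), a set \<open>A\<close> is cut down to at most half of \<open>Y\<close> by discarding at most
  \<open>2\<alpha>\<^sub>k|X|\<close> points, which is negligible against \<open>|A|\<close> once \<open>\<alpha>\<^sub>k\<close> is small compared to \<open>\<alpha>\<close>.
\<close>

section \<open>Boundaries and neighbourhoods in finite metric spaces\<close>

text \<open>A finite non-empty infimum is attained, so closeness to \<open>A\<close> has a witness
  in \<open>A\<close>. Over the empty set the infimum is infinity, so no point qualifies.\<close>

lemma R_boundary_finite_iff:
  assumes "finite A"
  shows "x \<in> R_boundary X d R A \<longleftrightarrow> x \<in> X \<and> x \<notin> A \<and> (\<exists>a\<in>A. d x a \<le> R)"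
proof (cases "A = {}")
  case True
  then show ?thesis by (simp add: R_boundary_def point_set_dist_def top_ereal_def)
next
  case False
  have "(INF a\<in>A. ereal (d x a)) = Min ((\<lambda>a. ereal (d x a)) ` A)"
    using assms False by (intro Min_Inf[symmetric]) auto
  moreover have "Min ((\<lambda>a. ereal (d x a)) ` A) \<le> ereal R \<longleftrightarrow> (\<exists>a\<in>A. d x a \<le> R)"
    using assms False by (subst Min_le_iff) auto
  ultimately show ?thesis
    by (auto simp: R_boundary_def point_set_dist_def)
qed

lemma R_boundary_subset: "R_boundary X d R A \<subseteq> X - A"
  by (auto simp: R_boundary_def)

lemma R_boundary_mono_radius:
  assumes "r \<le> s"
  shows "R_boundary X d r A \<subseteq> R_boundary X d s A"
  using assms by (auto simp: R_boundary_def intro: order_trans)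

definition R_neighbourhood :: "'a set \<Rightarrow> ('a \<Rightarrow> 'a \<Rightarrow> real) \<Rightarrow> real \<Rightarrow> 'a set \<Rightarrow> 'a set" where
  "R_neighbourhood X d R A = A \<union> R_boundary X d R A"

lemma R_neighbourhood_subset: "A \<subseteq> X \<Longrightarrow> R_neighbourhood X d R A \<subseteq> X"
  using R_boundary_subset by (fastforce simp: R_neighbourhood_def)

lemma card_R_neighbourhood:
  assumes "finite X" "A \<subseteq> X"
  shows "card (R_neighbourhood X d R A) = card A + card (R_boundary X d R A)"
proof -
  have "A \<inter> R_boundary X d R A = {}" "finite A" "finite (R_boundary X d R A)"
    using assms R_boundary_subset[of X d R A] by (auto intro: finite_subset)
  then show ?thesis
    unfolding R_neighbourhood_def by (rule card_Un_disjoint[rotated 2])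
qed

text \<open>The triangle inequality. Nonnegative radii let a point of the inner set serve as its own
  witness, at distance 0.\<close>

lemma R_neighbourhood_R_neighbourhood:
  assumes "Metric_space X d" "finite X" "A \<subseteq> X" "0 \<le> r" "0 \<le> s"
  shows "R_neighbourhood X d r (R_neighbourhood X d s A) \<subseteq> R_neighbourhood X d (s + r) A"
proof
  interpret Metric_space X d by fact
  have fA: "finite A" using assms(3,2) by (rule finite_subset)
  have fN: "finite (R_neighbourhood X d s A)"
    using R_neighbourhood_subset[OF assms(3)] assms(2) by (rule finite_subset)
  fix x assume x: "x \<in> R_neighbourhood X d r (R_neighbourhood X d s A)"
  then have xX: "x \<in> X"
    using R_neighbourhood_subset[OF R_neighbourhood_subset[OF assms(3)]] by blast
  obtain y where y: "y \<in> R_neighbourhood X d s A" "d x y \<le> r"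
    using x xX fN mdist_zero[OF xX] \<open>0 \<le> r\<close>
    by (auto simp: R_neighbourhood_def[of X d r] R_boundary_finite_iff)
  have yX: "y \<in> X"
    using y(1) R_neighbourhood_subset[OF assms(3)] by blast
  obtain a where a: "a \<in> A" "d y a \<le> s"
    using y(1) yX fA mdist_zero[OF yX] \<open>0 \<le> s\<close>
    by (auto simp: R_neighbourhood_def R_boundary_finite_iff)
  have "d x a \<le> s + r"
    using triangle[OF xX yX, of a] a y assms(3) by auto
  then show "x \<in> R_neighbourhood X d (s + r) A"
    using a(1) xX fA by (auto simp: R_neighbourhood_def R_boundary_finite_iff)
qed

section \<open>Making the expansion constant independent of \<alpha>\<close>

definition expands_above ::
  "'a set \<Rightarrow> ('a \<Rightarrow> 'a \<Rightarrow> real) \<Rightarrow> real \<Rightarrow> real \<Rightarrow> real \<Rightarrow> bool" where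
  "expands_above X d \<alpha> c R \<longleftrightarrow>
    (\<forall>A \<subseteq> X. \<alpha> * real (card X) \<le> real (card A) \<and> real (card A) \<le> 1/2 * real (card X) \<longrightarrow>
      real (card (R_boundary X d R A)) > c * real (card A))"

lemma asymptotic_expanders_iff:
  "asymptotic_expanders X d \<longleftrightarrow>
    (\<forall>\<alpha>. 0 < \<alpha> \<and> \<alpha> \<le> 1/2 \<longrightarrow>
      (\<exists>c R. 0 < c \<and> c < 1 \<and> 0 < R \<and> (\<forall>n. expands_above (X n) (d n) \<alpha> c R)))"
  by (simp add: asymptotic_expanders_def expands_above_def)

text \<open>A neighbourhood of at most half of \<open>X\<close> contains \<open>A\<close>, so the
  hypothesis applies to it and the next enlargement gains more than
  \<open>c * \<alpha> * card X\<close> points. Past half the hypothesis is silent, but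
  neighbourhoods never shrink; hence the disjunction.\<close>

lemma iterated_neighbourhood_growth:
  assumes "Metric_space X d" "finite X" "expands_above X d \<alpha> c R" "0 < c" "0 < R"
    and A: "A \<subseteq> X" "\<alpha> * real (card X) \<le> real (card A)"
  shows "real (card (R_neighbourhood X d (real m * R) A)) > 1/2 * real (card X) \<or>
    real (card (R_neighbourhood X d (real m * R) A)) \<ge> real m * (c * \<alpha> * real (card X))"
proof (induction m)
  case 0
  then show ?case by simp
next
  case (Suc m)
  let ?N = "R_neighbourhood X d (real m * R) A"
  let ?N' = "R_neighbourhood X d (real (Suc m) * R) A"
  have NX: "?N \<subseteq> X" and N'X: "?N' \<subseteq> X"
    using A(1) by (simp_all add: R_neighbourhood_subset)
  have "R_neighbourhood X d R ?N \<subseteq> ?N'"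
    using R_neighbourhood_R_neighbourhood[OF assms(1,2) A(1), of R "real m * R"] \<open>0 < R\<close>
    by (simp add: algebra_simps)
  then have "card (R_neighbourhood X d R ?N) \<le> card ?N'"
    using N'X \<open>finite X\<close> by (meson card_mono finite_subset)
  then have step: "card ?N + card (R_boundary X d R ?N) \<le> card ?N'"
    using card_R_neighbourhood[OF \<open>finite X\<close> NX] by simp
  show ?case
  proof (cases "real (card ?N) > 1/2 * real (card X)")
    case True
    then show ?thesis using step by linarith
  next
    case False
    have "card A \<le> card ?N"
      using card_R_neighbourhood[OF assms(2) A(1)] by simp
    then have large: "\<alpha> * real (card X) \<le> real (card ?N)"
      using A(2) by linarith
    then have "c * real (card ?N) < real (card (R_boundary X d R ?N))"
      using assms(3) NX False unfolding expands_above_def by (simp add: not_less)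
    moreover have "c * (\<alpha> * real (card X)) \<le> c * real (card ?N)"
      using large \<open>0 < c\<close> by simp
    moreover have "real (card ?N) \<ge> real m * (c * \<alpha> * real (card X))"
      using Suc.IH False by simp
    ultimately show ?thesis using step by (simp add: algebra_simps)
  qed
qed

lemma expands_above_uniform_constant:
  assumes "Metric_space X d" "finite X" "X \<noteq> {}"
    and "expands_above X d \<alpha> c R" "0 < c" "0 < R" "0 < \<alpha>"
    and "expands_above X d (1/4) c\<^sub>0 R\<^sub>0" "0 < c\<^sub>0" "c\<^sub>0 < 1"
    and m: "1 \<le> real m * (c * \<alpha>)"
  shows "expands_above X d \<alpha> c\<^sub>0 (max R\<^sub>0 (real m * R))"
  unfolding expands_above_def
proof (intro allI impI, elim conjE)
  fix A assume A: "A \<subseteq> X" "\<alpha> * real (card X) \<le> real (card A)"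
    "real (card A) \<le> 1/2 * real (card X)"
  let ?S = "max R\<^sub>0 (real m * R)"
  have cX: "0 < card X" using assms(1-3) by (simp add: card_gt_0_iff)
  have cA: "0 < real (card A)"
    using A(2) cX \<open>0 < \<alpha>\<close> by (smt (verit) mult_pos_pos of_nat_0_less_iff)
  have mono: "card (R_boundary X d r A) \<le> card (R_boundary X d ?S A)" if "r \<le> ?S" for r
    using R_boundary_mono_radius[OF that] R_boundary_subset \<open>finite X\<close>
    by (metis card_mono finite_Diff finite_subset)
  show "c\<^sub>0 * real (card A) < real (card (R_boundary X d ?S A))"
  proof (cases "1/4 * real (card X) \<le> real (card A)")
    case True
    then have "c\<^sub>0 * real (card A) < real (card (R_boundary X d R\<^sub>0 A))"
      using assms(8) A unfolding expands_above_def by blast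
    then show ?thesis using mono[of R\<^sub>0] by simp
  next
    case False
    \<comment> \<open>By the choice of \<open>m\<close> the second alternative of the growth lemma
      exceeds half of \<open>X\<close> as well.\<close>
    have "real (card X) \<le> real m * (c * \<alpha> * real (card X))"
      using mult_right_mono[OF m, of "real (card X)"] by (simp add: mult.assoc)
    then have "real (card (R_neighbourhood X d (real m * R) A)) \<ge> 1/2 * real (card X)"
      using iterated_neighbourhood_growth[OF assms(1,2,4,5,6) A(1,2), of m] by linarith
    \<comment> \<open>Since \<open>A\<close> has fewer than a quarter of the points, the
      neighbourhood has more than twice as many points as \<open>A\<close>.\<close>
    then have "real (card (R_boundary X d (real m * R) A)) > real (card A)"
      using False card_R_neighbourhood[OF assms(2) A(1), of d "real m * R"] by simp
    moreover have "c\<^sub>0 * real (card A) < real (card A)"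
      using cA \<open>c\<^sub>0 < 1\<close> by simp
    ultimately show ?thesis using mono[of "real m * R"] by simp
  qed
qed

lemma asymptotic_expanders_uniform_constant:
  assumes "\<And>n. Metric_space (X n) (d n)" "\<And>n. finite (X n)" "\<And>n. X n \<noteq> {}"
    and "asymptotic_expanders X d"
  obtains c where "0 < c" "c < 1"
    "\<And>\<alpha>. 0 < \<alpha> \<Longrightarrow> \<alpha> \<le> 1/2 \<Longrightarrow> \<exists>R>0. \<forall>n. expands_above (X n) (d n) \<alpha> c R"
proof -
  obtain c\<^sub>0 R\<^sub>0 where c0: "0 < c\<^sub>0" "c\<^sub>0 < 1" "0 < R\<^sub>0"
      "\<And>n. expands_above (X n) (d n) (1/4) c\<^sub>0 R\<^sub>0"
    using assms(4)[unfolded asymptotic_expanders_iff, rule_format, of "1/4"] by auto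
  have "\<exists>R>0. \<forall>n. expands_above (X n) (d n) \<alpha> c\<^sub>0 R" if \<alpha>: "0 < \<alpha>" "\<alpha> \<le> 1/2" for \<alpha>
  proof -
    obtain c R where c: "0 < c" "0 < R" "\<And>n. expands_above (X n) (d n) \<alpha> c R"
      using assms(4) \<alpha> unfolding asymptotic_expanders_iff by blast
    \<comment> \<open>\<open>m\<close> depends on \<alpha> but not on \<open>n\<close>, so the
      enlarged radius serves every space.\<close>
    obtain m where "1 / (c * \<alpha>) \<le> real m"
      using real_arch_simple by blast
    then have "1 \<le> real m * (c * \<alpha>)"
      using c \<alpha> by (simp add: divide_le_eq)
    then have "expands_above (X n) (d n) \<alpha> c\<^sub>0 (max R\<^sub>0 (real m * R))" for n
      using expands_above_uniform_constant[OF assms(1-3) c(3,1,2) \<alpha>(1) c0(4,1,2)] by blast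
    moreover have "0 < max R\<^sub>0 (real m * R)" using c0 by simp
    ultimately show ?thesis by blast
  qed
  then show thesis using that c0 by blast
qed

section \<open>Deleting a maximal non-expanding set\<close>

definition expander_at_scale :: "'a set \<Rightarrow> ('a \<Rightarrow> 'a \<Rightarrow> real) \<Rightarrow> real \<Rightarrow> real \<Rightarrow> bool" where
  "expander_at_scale Y d c R \<longleftrightarrow>
    (\<forall>A \<subseteq> Y. A \<noteq> {} \<and> real (card A) \<le> 1/2 * real (card Y) \<longrightarrow>
      real (card (R_boundary Y d R A)) > c * real (card A))"

text \<open>The bound \<open>c / 8\<close> is used twice: it keeps \<open>F\<close> below an eighth
  of \<open>X\<close>, and it makes \<open>F\<close> smaller than \<open>c / 2 * card A\<close> once
  \<open>A\<close> has over a quarter of the points. So deleting \<open>F\<close> costs at most half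
  of the constant \<open>c\<close>.\<close>

lemma expands_above_imp_large_expander:
  assumes "finite X" "X \<noteq> {}" "expands_above X d \<alpha> c R" "0 < c" "c < 1"
    and \<alpha>: "0 < \<alpha>" "\<alpha> \<le> c / 8"
  shows "\<exists>Y \<subseteq> X. real (card Y) \<ge> (1 - \<alpha>) * real (card X) \<and> expander_at_scale Y d (c / 2) R"
proof -
  have cX: "0 < real (card X)" using assms(1-3) by (simp add: card_gt_0_iff)
  define P where "P F \<longleftrightarrow> F \<subseteq> X \<and> real (card F) \<le> 1/2 * real (card X) \<and>
    real (card (R_boundary X d R F)) \<le> c / 2 * real (card F)" for F
  have "P {}"
    unfolding P_def by (auto simp: R_boundary_finite_iff card_eq_0_iff)
  moreover have "\<forall>F. P F \<longrightarrow> card F < Suc (card X)"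
    using card_mono[OF assms(1)] unfolding P_def less_Suc_eq_le by blast
  ultimately have "\<exists>F. P F \<and> (\<forall>G. P G \<longrightarrow> card G \<le> card F)"
    by (rule ex_has_greatest_nat)
  then obtain F where F: "P F" and max: "\<And>G. P G \<Longrightarrow> card G \<le> card F"
    by blast
  have FX: "F \<subseteq> X" using F by (simp add: P_def)
  then have fF: "finite F" using assms(1) by (rule finite_subset)
  have small: "real (card F) < \<alpha> * real (card X)"
  proof (rule ccontr)
    assume "\<not> ?thesis"
    then have "c * real (card F) < real (card (R_boundary X d R F))"
      using F assms(3) unfolding P_def expands_above_def by simp
    moreover have "c / 2 * real (card F) \<le> c * real (card F)"
      using \<open>0 < c\<close> by simp
    ultimately show False using F unfolding P_def by linarith
  qed
  define Y where "Y = X - F"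
  have cardY: "real (card Y) = real (card X) - real (card F)"
    using FX assms(1) card_mono[OF assms(1) FX]
    by (simp add: Y_def card_Diff_subset fF of_nat_diff)
  have "expander_at_scale Y d (c / 2) R"
    unfolding expander_at_scale_def
  proof (intro allI impI, elim conjE)
    fix A assume A: "A \<subseteq> Y" "A \<noteq> {}" "real (card A) \<le> 1/2 * real (card Y)"
    let ?B = "R_boundary Y d R A"
    have fA: "finite A" and AX: "A \<subseteq> X" and fB: "finite ?B" and AF: "A \<inter> F = {}"
      using A(1) assms(1) R_boundary_subset[of Y d R A]
      by (auto simp: Y_def intro: finite_subset)
    have cardU: "card (A \<union> F) = card A + card F"
      using fA fF AF by (rule card_Un_disjoint)
    show "c / 2 * real (card A) < real (card ?B)"
    proof (rule ccontr)
      assume neg: "\<not> ?thesis"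
      \<comment> \<open>A boundary point of the union is near \<open>F\<close>, or it is near
        \<open>A\<close> and lies in \<open>Y\<close>; so the two non-expansion bounds add
        up.\<close>
      have "R_boundary X d R (A \<union> F) \<subseteq> ?B \<union> R_boundary X d R F"
        using fA fF by (auto simp: R_boundary_finite_iff Y_def)
      moreover have "finite (R_boundary X d R F)"
        using R_boundary_subset[of X d R F] assms(1) by (auto intro: finite_subset)
      ultimately have "card (R_boundary X d R (A \<union> F)) \<le> card ?B + card (R_boundary X d R F)"
        using fB by (meson card_Un_le card_mono finite_UnI order_trans)
      then have "real (card (R_boundary X d R (A \<union> F))) \<le> c / 2 * real (card (A \<union> F))"
        using neg F cardU unfolding P_def by (simp add: algebra_simps)
      moreover have "\<not> card (A \<union> F) \<le> card F"
        using cardU fA A(2) by (simp add: card_gt_0_iff)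
      \<comment> \<open>The union is strictly larger than the maximal \<open>F\<close>, so it
        violates \<open>P\<close>, and only the size bound can fail.\<close>
      ultimately have "real (card (A \<union> F)) > 1/2 * real (card X)"
        using max[of "A \<union> F"] AX FX unfolding P_def by (meson Un_least not_le)
      moreover have eighth: "\<alpha> * real (card X) \<le> 1/8 * real (card X)"
        using \<alpha> \<open>c < 1\<close> by (intro mult_right_mono) auto
      ultimately have big: "real (card A) > 1/4 * real (card X)"
        unfolding cardU using small cX by linarith
      have "real (card A) \<le> 1/2 * real (card X)"
        using A(3) cardY by simp
      moreover have "\<alpha> * real (card X) \<le> real (card A)"
        using big eighth cX by linarith
      ultimately have "c * real (card A) < real (card (R_boundary X d R A))"
        using assms(3) AX unfolding expands_above_def by blast
      moreover have "R_boundary X d R A \<subseteq> ?B \<union> F"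
        using fA by (auto simp: R_boundary_finite_iff Y_def)
      then have "card (R_boundary X d R A) \<le> card ?B + card F"
        using fB fF by (meson card_Un_le card_mono finite_UnI order_trans)
      moreover have "\<alpha> * real (card X) \<le> c / 8 * real (card X)"
        using \<alpha>(2) by (intro mult_right_mono) auto
      moreover have "c / 2 * (1/4 * real (card X)) < c / 2 * real (card A)"
        using big \<open>0 < c\<close> by (intro mult_strict_left_mono) auto
      ultimately show False
        using neg small by (simp add: algebra_simps)
    qed
  qed
  moreover have "real (card Y) \<ge> (1 - \<alpha>) * real (card X)"
    using cardY small by (simp add: algebra_simps)
  moreover have "Y \<subseteq> X" by (auto simp: Y_def)
  ultimately show ?thesis by blast
qed

section \<open>From a large expanding subset back to the whole space\<close>

text \<open>With \<open>t\<close> points outside \<open>Y\<close>, the trimmed set \<open>C\<close>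
  loses at most \<open>2 * t\<close> points of \<open>A\<close>, and at most \<open>t\<close> points
  of its boundary lie in \<open>A\<close>. The total loss \<open>(2 * c + 1) * t\<close> is at most
  \<open>c / 2 * card A\<close> by the hypothesis on \<beta>.\<close>

lemma large_expander_imp_expands_above:
  assumes "finite X" "X \<noteq> {}" "Y \<subseteq> X"
    and Y: "real (card Y) \<ge> (1 - \<beta>) * real (card X)" "expander_at_scale Y d c R"
    and "0 < c" "0 < \<alpha>" "2 * (2 * c + 1) * \<beta> \<le> c * \<alpha>"
  shows "expands_above X d \<alpha> (c / 2) R"
  unfolding expands_above_def
proof (intro allI impI, elim conjE)
  fix A assume A: "A \<subseteq> X" "\<alpha> * real (card X) \<le> real (card A)"
    "real (card A) \<le> 1/2 * real (card X)"
  have cX: "0 < real (card X)" using assms(1-3) by (simp add: card_gt_0_iff)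
  have fA: "finite A" using A(1) assms(1) by (rule finite_subset)
  have fY: "finite Y" using assms(3,1) by (rule finite_subset)
  have cA: "0 < real (card A)"
    using A(2) cX \<open>0 < \<alpha>\<close> by (smt (verit) mult_pos_pos)
  define t where "t = card X - card Y"
  have YX: "card Y \<le> card X" using assms(1,3) by (simp add: card_mono)
  have tr: "real t = real (card X) - real (card Y)"
    using YX by (simp add: t_def of_nat_diff)
  have t: "real t \<le> \<beta> * real (card X)"
    using Y(1) tr by (simp add: algebra_simps)
  have "2 * (2 * c + 1) * real t \<le> 2 * (2 * c + 1) * (\<beta> * real (card X))"
    using t \<open>0 < c\<close> by (intro mult_left_mono) auto
  also have "\<dots> \<le> c * \<alpha> * real (card X)"
    using mult_right_mono[OF assms(8), of "real (card X)"] by (simp add: mult.assoc)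
  also have "\<dots> \<le> c * real (card A)"
    using A(2) \<open>0 < c\<close> by (simp add: mult.assoc)
  finally have loss: "2 * (2 * c + 1) * real t \<le> c * real (card A)" .
  have B: "card A \<le> card (A \<inter> Y) + t"
  proof -
    have "card A \<le> card (A \<inter> Y) + card (X - Y)"
    proof -
      have "A \<subseteq> (A \<inter> Y) \<union> (X - Y)" using A(1) by auto
      then have "card A \<le> card ((A \<inter> Y) \<union> (X - Y))"
        using assms(1) fA by (intro card_mono) auto
      then show ?thesis using card_Un_le order_trans by blast
    qed
    then show ?thesis using assms(3) fY by (simp add: t_def card_Diff_subset)
  qed
  \<comment> \<open>If \<open>A \<inter> Y\<close> exceeds half of \<open>Y\<close> then \<open>Y \<noteq> X\<close>, so \<open>1 \<le> t\<close> absorbs the rounding error.\<close>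
  have "card (A \<inter> Y) \<le> card Y div 2 + t"
  proof (cases "t = 0")
    case True
    have "card (A \<inter> Y) \<le> card A" using fA by (simp add: card_mono)
    then show ?thesis using A(3) True YX unfolding t_def by linarith
  next
    case False
    have "card (A \<inter> Y) \<le> card A" using fA by (simp add: card_mono)
    then show ?thesis using A(3) False YX unfolding t_def by linarith
  qed
  \<comment> \<open>The minimum covers both cases: \<open>C\<close> is all of
    \<open>A \<inter> Y\<close> if that already fits into half of \<open>Y\<close>.\<close>
  moreover obtain C where "C \<subseteq> A \<inter> Y" "card C = min (card (A \<inter> Y)) (card Y div 2)" "finite C"
    using obtain_subset_with_card_n[OF min.cobounded1] .
  ultimately have C: "C \<subseteq> A \<inter> Y" "card C \<le> card Y div 2" "card (A \<inter> Y) \<le> card C + t"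
    and fC: "finite C"
    by simp_all
  have CA: "real (card A) \<le> real (card C) + 2 * real t"
    using B C(3) by linarith
  \<comment> \<open>Expansion in \<open>Y\<close> concerns non-empty sets only; an empty
    \<open>C\<close> would force \<open>A\<close> to have at most \<open>2 * t\<close>
    points.\<close>
  have "C \<noteq> {}"
  proof
    assume "C = {}"
    then have "c * real (card A) \<le> c * (2 * real t)"
      using CA \<open>0 < c\<close> by (intro mult_left_mono) auto
    moreover have "0 < c * real (card A)" using cA \<open>0 < c\<close> by simp
    ultimately show False using loss by (simp add: algebra_simps)
  qed
  moreover have "real (card C) \<le> 1/2 * real (card Y)" using C(2) by linarith
  ultimately have exp: "c * real (card C) < real (card (R_boundary Y d R C))"
    using Y(2) C(1) unfolding expander_at_scale_def by blast
  have "R_boundary Y d R C \<subseteq> R_boundary X d R A \<union> (A \<inter> Y - C)"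
    using fC fA C(1) assms(3) unfolding subset_iff Un_iff Diff_iff Int_iff
    by (simp add: R_boundary_finite_iff) blast
  moreover have "finite (R_boundary X d R A)"
    using R_boundary_subset[of X d R A] assms(1) by (auto intro: finite_subset)
  ultimately have "card (R_boundary Y d R C) \<le> card (R_boundary X d R A) + card (A \<inter> Y - C)"
    using fA by (meson card_Un_le card_mono finite_UnI finite_Diff finite_Int order_trans)
  also have "card (A \<inter> Y - C) \<le> t"
    using C fC by (simp add: card_Diff_subset)
  finally have "real (card (R_boundary Y d R C)) \<le> real (card (R_boundary X d R A)) + real t"
    by linarith
  moreover have "c * real (card A) \<le> c * (real (card C) + 2 * real t)"
    using CA \<open>0 < c\<close> by (intro mult_left_mono) auto
  ultimately show "c / 2 * real (card A) < real (card (R_boundary X d R A))"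
    using exp loss by (simp add: algebra_simps)
qed

lemma expands_above_smaller_constant:
  assumes "expands_above X d \<alpha> c R" "c' \<le> c"
  shows "expands_above X d \<alpha> c' R"
  using assms unfolding expands_above_def
  by (meson le_less_trans mult_right_mono of_nat_0_le_iff)

section \<open>The equivalence for sequences\<close>

theorem theorem3p7:
  fixes X :: "nat \<Rightarrow> 'a set" and d :: "nat \<Rightarrow> 'a \<Rightarrow> 'a \<Rightarrow> real"
  assumes "\<And>n. Metric_space (X n) (d n)"
    and "\<And>n. finite (X n)"
    and "\<And>n. X n \<noteq> {}"
    and "filterlim (\<lambda>n. card (X n)) at_top sequentially"
  shows "asymptotic_expanders X d \<longleftrightarrow>
    (\<exists>(c::real) (\<alpha>::nat \<Rightarrow> real) (R::nat \<Rightarrow> real) (Y::nat \<Rightarrow> nat \<Rightarrow> 'a set).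
       c > 0 \<and>
       (\<forall>k. \<alpha> k > 0) \<and> decseq \<alpha> \<and> \<alpha> \<longlonglongrightarrow> 0 \<and>
       (\<forall>k. R k > 0) \<and>
       (\<forall>n k. Y n k \<subseteq> X n) \<and>
       (\<forall>n k. real (card (Y n k)) \<ge> (1 - \<alpha> k) * real (card (X n))) \<and>
       (\<forall>n k. \<forall>A \<subseteq> Y n k. A \<noteq> {} \<and> real (card A) \<le> 1/2 * real (card (Y n k)) \<longrightarrow>
          real (card (R_boundary (Y n k) (d n) (R k) A)) > c * real (card A)))"
proof -
  have "asymptotic_expanders X d \<longleftrightarrow>
    (\<exists>(c::real) (\<alpha>::nat \<Rightarrow> real) (R::nat \<Rightarrow> real) (Y::nat \<Rightarrow> nat \<Rightarrow> 'a set).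
       c > 0 \<and> (\<forall>k. \<alpha> k > 0) \<and> decseq \<alpha> \<and> \<alpha> \<longlonglongrightarrow> 0 \<and> (\<forall>k. R k > 0) \<and>
       (\<forall>n k. Y n k \<subseteq> X n) \<and>
       (\<forall>n k. real (card (Y n k)) \<ge> (1 - \<alpha> k) * real (card (X n))) \<and>
       (\<forall>n k. expander_at_scale (Y n k) (d n) c (R k)))" (is "?L \<longleftrightarrow> ?R")
  proof
    assume ?L
    then obtain c where c: "0 < c" "c < 1"
        "\<And>\<alpha>. 0 < \<alpha> \<Longrightarrow> \<alpha> \<le> 1/2 \<Longrightarrow> \<exists>R>0. \<forall>n. expands_above (X n) (d n) \<alpha> c R"
      using asymptotic_expanders_uniform_constant[of X d] assms(1-3) by blast
    \<comment> \<open>The factor \<open>c / 8\<close> keeps every term within the bound under which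
      a non-expanding set can be deleted.\<close>
    define \<alpha> where "\<alpha> k = c / 8 * inverse (real (Suc k))" for k
    have \<alpha>: "0 < \<alpha> k" "\<alpha> k \<le> c / 8" for k
      using c(1) by (simp_all add: \<alpha>_def field_simps)
    have "\<exists>R>0. \<forall>n. expands_above (X n) (d n) (\<alpha> k) c R" for k
      using c(2) \<alpha>[of k] by (intro c(3)) auto
    then obtain R where R: "\<And>k. 0 < R k" "\<And>k n. expands_above (X n) (d n) (\<alpha> k) c (R k)"
      by metis
    have "\<exists>Y \<subseteq> X n. real (card Y) \<ge> (1 - \<alpha> k) * real (card (X n)) \<and>
        expander_at_scale Y (d n) (c / 2) (R k)" for n k
      using expands_above_imp_large_expander[OF assms(2,3) R(2) c(1,2) \<alpha>] .
    then obtain Y where "\<And>n k. Y n k \<subseteq> X n"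
        "\<And>n k. real (card (Y n k)) \<ge> (1 - \<alpha> k) * real (card (X n))"
        "\<And>n k. expander_at_scale (Y n k) (d n) (c / 2) (R k)"
      by metis
    moreover have "decseq \<alpha>"
      using c(1) by (auto simp: decseq_def \<alpha>_def field_simps)
    moreover have "\<alpha> \<longlonglongrightarrow> 0"
      unfolding \<alpha>_def by (rule tendsto_mult_right_zero[OF LIMSEQ_inverse_real_of_nat])
    moreover have "0 < c / 2" using c(1) by simp
    ultimately show ?R using \<alpha>(1) R(1) by blast
  next
    assume ?R
    then obtain c \<alpha> R Y where c: "c > 0" "\<alpha> \<longlonglongrightarrow> 0" and R: "\<And>k. R k > 0"
      and Y: "\<And>n k. Y n k \<subseteq> X n" "\<And>n k. real (card (Y n k)) \<ge> (1 - \<alpha> k) * real (card (X n))"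
        "\<And>n k. expander_at_scale (Y n k) (d n) c (R k)"
      by blast
    show ?L
      unfolding asymptotic_expanders_iff
    proof (intro allI impI, elim conjE)
      fix a :: real assume a: "0 < a" "a \<le> 1/2"
      have "0 < c * a / (2 * (2 * c + 1))"
        using c(1) a(1) by simp
      then have "\<forall>\<^sub>F k in sequentially. \<alpha> k < c * a / (2 * (2 * c + 1))"
        using order_tendstoD(2)[OF c(2)] by blast
      \<comment> \<open>\<open>k\<close> is chosen from \<open>a\<close> alone, so the single radius
        \<open>R k\<close> works for all \<open>n\<close>.\<close>
      then obtain k where "\<alpha> k < c * a / (2 * (2 * c + 1))"
        using eventually_happens'[OF sequentially_bot] by blast
      then have k: "2 * (2 * c + 1) * \<alpha> k \<le> c * a"
        using c(1) by (simp add: field_simps)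
      \<comment> \<open>Nothing bounds \<open>c\<close> from above here, while asymptotic expansion
        asks for a constant below 1; hence the minimum.\<close>
      have "expands_above (X n) (d n) a (min (c / 2) (1/2)) (R k)" for n
        using large_expander_imp_expands_above[OF assms(2,3) Y c(1) a(1) k]
        by (rule expands_above_smaller_constant) simp
      moreover have "0 < min (c / 2) (1/2)" "min (c / 2) (1/2) < 1"
        using c(1) by auto
      ultimately show "\<exists>c R. 0 < c \<and> c < 1 \<and> 0 < R \<and> (\<forall>n. expands_above (X n) (d n) a c R)"
        using R by blast
    qed
  qed
  then show ?thesis unfolding expander_at_scale_def .
qed

end
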